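(* Let $\mathcal{M}$ be a gridding matrix, and let $A$ be an antichain (under permutation containment) infinitely many of whose elements are strongly uniquely $\mathcal{M}$-griddable. Then for any gridding matrix $\mathcal{N}$ equivalent to $\mathcal{M}$ under some grid mapping, the grid class $\mathrm{Grid}(\mathcal{N})$ is not partially well-ordered.
   Context: $\alpha\le\pi$ means $\pi$ has a subsequence order isomorphic to $\alpha$; an antichain is a set of pairwise incomparable permutations; a set is partially well-ordered if it has no infinite antichain. A gridding matrix is an $m\times n$ matrix of permutation classes (infinite or empty), with $\mathcal{M}_{ij}$ in column $i$, row $j$ counted from the bottom-left. An $\mathcal{M}$-gridding of a permutation is a choice of $m-1$ vertical and $n-1$ horizontal lines dividing its plot $\{(i,\pi(i))\}$ into cells so that the points in cell $ij$ are order isomorphic to an element of $\mathcal{M}_{ij}$; an $\mathcal{M}$-gridded permutation is a permutation equipped with one; $\mathrm{Grid}(\mathcal{M})$ is the class of permutations having an $\mathcal{M}$-gridding. Grid mappings: (i) grid inverse $\phi$: $(\phi(\mathcal{M}))_{ij}=(\mathcal{M}_{ji})^{-1}$, acting on gridded permutations by $\pi\mapsto\pi^{-1}$ with vertical and horizontal grid lines interchanged; (ii) $i$th column reverse $r_i$: entries of column $i$ replaced by their reverse classes, and on gridded permutations the points of column $i$ are reversed in position within that column; (iii) $j$th row complement $c_j$: entries of row $j$ replaced by their complement classes, and on gridded permutations the values of points in row $j$ are complemented within that row; (iv) column permutation $\mu$: $(\mu(\mathcal{M}))_{ij}=\mathcal{M}_{\mu(i)j}$, and on gridded permutations column $i$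 of the image is column $\mu(i)$ of the original; (v) row permutation $\nu$: $(\nu(\mathcal{M}))_{ij}=\mathcal{M}_{i\nu(j)}$, analogously. A grid mapping is any composition of these; $\mathcal{M}$ and $\mathcal{N}$ are equivalent under the grid mapping $f$ if $f(\mathcal{M})=\mathcal{N}$. An $\mathcal{M}$-gridded permutation $\pi$ is strongly uniquely $\mathcal{M}$-griddable if its given $\mathcal{M}$-gridding is the only $\mathcal{M}$-gridding of the underlying permutation and, for every grid mapping $f$ of $\mathcal{M}$, the induced $f(\mathcal{M})$-gridding of $f(\pi)$ is the only $f(\mathcal{M})$-gridding of the underlying permutation of $f(\pi)$. *)

theory Defs
  imports
    "HOL-Library.Sublist"
    "HOL-Combinatorics.Combinatorics"
    "Jordan_Normal_Form.Matrix"
begin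

text \<open>A permutation of length \<open>n\<close> is its one-line notation, with values and positions
  \<open>0, \<dots>, n - 1\<close>.\<close>

definition perms :: "nat list set" where
  "perms = (\<Union>n. permutations_of_set {..<n})"

definition order_iso :: "nat list \<Rightarrow> nat list \<Rightarrow> bool" where
  "order_iso xs ys \<longleftrightarrow> length xs = length ys \<and>
     (\<forall>i<length xs. \<forall>j<length xs. xs ! i < xs ! j \<longleftrightarrow> ys ! i < ys ! j)"

definition contained :: "nat list \<Rightarrow> nat list \<Rightarrow> bool" (infix "\<preceq>" 50) where
  "\<alpha> \<preceq> \<pi> \<longleftrightarrow> (\<exists>s. subseq s \<pi> \<and> order_iso s \<alpha>)"

definition perm_antichain :: "nat list set \<Rightarrow> bool" where
  "perm_antichain A \<longleftrightarrow> A \<subseteq> perms \<and> (\<forall>\<alpha>\<in>A. \<forall>\<beta>\<in>A. \<alpha> \<noteq> \<beta> \<longrightarrow> \<not> \<alpha> \<preceq> \<beta> \<and> \<not> \<beta> \<preceq> \<alpha>)"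

definition partially_well_ordered :: "nat list set \<Rightarrow> bool" where
  "partially_well_ordered C \<longleftrightarrow> \<not> (\<exists>A\<subseteq>C. infinite A \<and> perm_antichain A)"

definition perm_class :: "nat list set \<Rightarrow> bool" where
  "perm_class C \<longleftrightarrow> C \<subseteq> perms \<and> (\<forall>\<pi>\<in>C. \<forall>\<alpha>\<in>perms. \<alpha> \<preceq> \<pi> \<longrightarrow> \<alpha> \<in> C)"

definition perm_inverse :: "nat list \<Rightarrow> nat list" where
  "perm_inverse \<pi> = map (inv_into {..<length \<pi>} ((!) \<pi>)) [0..<length \<pi>]"

definition perm_complement :: "nat list \<Rightarrow> nat list" where
  "perm_complement \<pi> = map (\<lambda>y. length \<pi> - Suc y) \<pi>"


text \<open>An \<open>m \<times> n\<close> gridding matrix has \<open>m\<close> columns and \<open>n\<close> rows and \<open>\<M>\<^sub>i\<^sub>j\<close> is the entry in column \<open>i\<close>,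
  row \<open>j\<close>, rows being counted from the bottom.  As \<^typ>\<open>'a mat\<close> is indexed by row first,
  \<open>\<M>\<^sub>i\<^sub>j\<close> is \<open>M $$ (j, i)\<close>, with \<open>m = dim_col M\<close>, \<open>n = dim_row M\<close>, and indices starting at 0.\<close>

definition gridding_matrix :: "nat list set mat \<Rightarrow> bool" where
  "gridding_matrix M \<longleftrightarrow> dim_col M > 0 \<and> dim_row M > 0 \<and>
     (\<forall>i<dim_col M. \<forall>j<dim_row M. perm_class (M $$ (j, i)) \<and>
        (infinite (M $$ (j, i)) \<or> M $$ (j, i) = {}))"

text \<open>A choice of \<open>m - 1\<close> lines cutting \<open>{0, \<dots>, k - 1}\<close> into \<open>m\<close> (possibly empty) intervals, given as
  \<open>0 = c\<^sub>0 \<le> c\<^sub>1 \<le> \<dots> \<le> c\<^sub>m = k\<close>.  The \<open>i\<close>th interval is \<open>{c ! i..<c ! Suc i}\<close>.\<close>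

definition dividers :: "nat \<Rightarrow> nat \<Rightarrow> nat list \<Rightarrow> bool" where
  "dividers m k c \<longleftrightarrow> length c = Suc m \<and> sorted c \<and> c ! 0 = 0 \<and> c ! m = k"

text \<open>A gridded permutation \<open>(\<pi>, c, r)\<close> consists of a permutation, the dividers for its columns
  (vertical lines) and the dividers for its rows (horizontal lines).\<close>

type_synonym gridded_perm = "nat list \<times> nat list \<times> nat list"

definition column_part :: "nat list \<Rightarrow> nat list \<Rightarrow> nat \<Rightarrow> nat list" where
  "column_part \<pi> c i = map ((!) \<pi>) [c ! i..<c ! Suc i]"

definition cell :: "gridded_perm \<Rightarrow> nat \<Rightarrow> nat \<Rightarrow> nat list" where
  "cell = (\<lambda>(\<pi>, c, r) i j. filter (\<lambda>y. y \<in> {r ! j..<r ! Suc j}) (column_part \<pi> c i))"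

text \<open>A cell without points is admissible for every class, in particular for the class \<open>{}\<close>;
  for an infinite class this is automatic, since it contains the permutation \<open>[]\<close>.\<close>

definition is_gridded :: "nat list set mat \<Rightarrow> gridded_perm \<Rightarrow> bool" where
  "is_gridded M = (\<lambda>(\<pi>, c, r). \<pi> \<in> perms \<and>
     dividers (dim_col M) (length \<pi>) c \<and> dividers (dim_row M) (length \<pi>) r \<and>
     (\<forall>i<dim_col M. \<forall>j<dim_row M. cell (\<pi>, c, r) i j = [] \<or>
        (\<exists>\<sigma>\<in>M $$ (j, i). order_iso (cell (\<pi>, c, r) i j) \<sigma>)))"

definition Grid :: "nat list set mat \<Rightarrow> nat list set" where
  "Grid M = {\<pi>. \<exists>c r. is_gridded M (\<pi>, c, r)}"

definition uniquely_gridded :: "nat list set mat \<Rightarrow> gridded_perm \<Rightarrow> bool" where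
  "uniquely_gridded M = (\<lambda>(\<pi>, c, r). is_gridded M (\<pi>, c, r) \<and>
     (\<forall>c' r'. is_gridded M (\<pi>, c', r') \<longrightarrow> c' = c \<and> r' = r))"


text \<open>The elementary grid mappings.  A grid mapping is a composition of these, represented by the
  list of its factors, the one applied first coming first.\<close>

datatype grid_op =
    Grid_Inverse
  | Column_Reverse nat
  | Row_Complement nat
  | Column_Perm "nat \<Rightarrow> nat"
  | Row_Perm "nat \<Rightarrow> nat"

type_synonym grid_mapping = "grid_op list"

fun op_applicable :: "grid_op \<Rightarrow> nat list set mat \<Rightarrow> bool" where
  "op_applicable Grid_Inverse M \<longleftrightarrow> True"
| "op_applicable (Column_Reverse i) M \<longleftrightarrow> i < dim_col M"
| "op_applicable (Row_Complement j) M \<longleftrightarrow> j < dim_row M"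
| "op_applicable (Column_Perm \<mu>) M \<longleftrightarrow> \<mu> permutes {..<dim_col M}"
| "op_applicable (Row_Perm \<nu>) M \<longleftrightarrow> \<nu> permutes {..<dim_row M}"

fun op_matrix :: "grid_op \<Rightarrow> nat list set mat \<Rightarrow> nat list set mat" where
  "op_matrix Grid_Inverse M =
     mat (dim_col M) (dim_row M) (\<lambda>(j, i). perm_inverse ` (M $$ (i, j)))"
| "op_matrix (Column_Reverse k) M =
     mat (dim_row M) (dim_col M) (\<lambda>(j, i). if i = k then rev ` (M $$ (j, i)) else M $$ (j, i))"
| "op_matrix (Row_Complement k) M =
     mat (dim_row M) (dim_col M)
       (\<lambda>(j, i). if j = k then perm_complement ` (M $$ (j, i)) else M $$ (j, i))"
| "op_matrix (Column_Perm \<mu>) M = mat (dim_row M) (dim_col M) (\<lambda>(j, i). M $$ (j, \<mu> i))"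
| "op_matrix (Row_Perm \<nu>) M = mat (dim_row M) (dim_col M) (\<lambda>(j, i). M $$ (\<nu> j, i))"

text \<open>The dividers after rearranging the intervals so that the \<open>i\<close>th new one is the \<open>\<mu> i\<close>th old one.\<close>

definition permute_dividers :: "(nat \<Rightarrow> nat) \<Rightarrow> nat list \<Rightarrow> nat list" where
  "permute_dividers \<mu> c = map (\<lambda>i. \<Sum>k<i. c ! Suc (\<mu> k) - c ! \<mu> k) [0..<length c]"

text \<open>In the last equation \<open>j\<close> is the new row of a point of value \<open>y\<close>, and \<open>\<nu> j\<close> is its old row.\<close>

fun op_gridded :: "grid_op \<Rightarrow> gridded_perm \<Rightarrow> gridded_perm" where
  "op_gridded Grid_Inverse (\<pi>, c, r) = (perm_inverse \<pi>, r, c)"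
| "op_gridded (Column_Reverse i) (\<pi>, c, r) =
     (take (c ! i) \<pi> @ rev (column_part \<pi> c i) @ drop (c ! Suc i) \<pi>, c, r)"
| "op_gridded (Row_Complement j) (\<pi>, c, r) =
     (map (\<lambda>y. if y \<in> {r ! j..<r ! Suc j} then r ! j + r ! Suc j - Suc y else y) \<pi>, c, r)"
| "op_gridded (Column_Perm \<mu>) (\<pi>, c, r) =
     (concat (map (\<lambda>i. column_part \<pi> c (\<mu> i)) [0..<length c - 1]), permute_dividers \<mu> c, r)"
| "op_gridded (Row_Perm \<nu>) (\<pi>, c, r) =
     (map (\<lambda>y. let j = (THE j. j < length r - 1 \<and> y \<in> {r ! \<nu> j..<r ! Suc (\<nu> j)})
               in permute_dividers \<nu> r ! j + (y - r ! \<nu> j)) \<pi>, c, permute_dividers \<nu> r)"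

definition map_matrix :: "grid_mapping \<Rightarrow> nat list set mat \<Rightarrow> nat list set mat" where
  "map_matrix f = fold op_matrix f"

definition map_gridded :: "grid_mapping \<Rightarrow> gridded_perm \<Rightarrow> gridded_perm" where
  "map_gridded f = fold op_gridded f"

text \<open>Each factor must be applicable to the matrix it acts on; note that \<^const>\<open>Grid_Inverse\<close>
  interchanges the two dimensions.\<close>

fun grid_mapping_of :: "nat list set mat \<Rightarrow> grid_mapping \<Rightarrow> bool" where
  "grid_mapping_of M [] \<longleftrightarrow> True"
| "grid_mapping_of M (u # f) \<longleftrightarrow> op_applicable u M \<and> grid_mapping_of (op_matrix u M) f"

definition equivalent_under :: "grid_mapping \<Rightarrow> nat list set mat \<Rightarrow> nat list set mat \<Rightarrow> bool" where
  "equivalent_under f M N \<longleftrightarrow> grid_mapping_of M f \<and> map_matrix f M = N"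

definition strongly_uniquely_griddable :: "nat list set mat \<Rightarrow> gridded_perm \<Rightarrow> bool" where
  "strongly_uniquely_griddable M g \<longleftrightarrow> uniquely_gridded M g \<and>
     (\<forall>f. grid_mapping_of M f \<longrightarrow> uniquely_gridded (map_matrix f M) (map_gridded f g))"

end

theory Submission
  imports Defs
begin

text \<open>Let \<open>f\<close> map \<open>M\<close> to \<open>N\<close>.  The images under \<open>f\<close> of the strongly uniquely griddable members of the
  antichain form an infinite antichain in \<open>Grid N\<close>.  For if the underlying permutation of \<open>f \<pi>\<close> is
  contained in that of \<open>f \<sigma>\<close>, then the \<open>N\<close>-gridding of \<open>f \<sigma>\<close> restricts to an \<open>N\<close>-gridding of \<open>f \<pi>\<close>,
  necessarily the given one, so that the embedding respects cells.  An embedding respecting cells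
  survives undoing the factors of \<open>f\<close> one at a time, whence \<open>\<pi> \<preceq> \<sigma>\<close> and \<open>\<pi> = \<sigma>\<close>.\<close>


section \<open>Containment of permutations\<close>

text \<open>A strictly increasing list is determined by its set of entries, so \<open>xs\<close> is
  what remains of \<open>ys\<close> after filtering by membership in \<open>xs\<close>.\<close>

lemma strict_sorted_subseq:
  fixes xs ys :: "nat list"
  assumes "sorted_wrt (<) xs" "sorted_wrt (<) ys" "set xs \<subseteq> set ys"
  shows "subseq xs ys"
proof -
  have "xs = filter (\<lambda>x. x \<in> set xs) ys"
    using assms
    by (intro strict_sorted_equal) (auto simp: sorted_wrt_filter)
  then show ?thesis
    by (metis subseq_filter_left)
qed

lemma subseq_embedding:
  assumes "subseq xs ys"
  obtains e where "strict_mono_on {..<length xs} e"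
    "\<And>i. i < length xs \<Longrightarrow> e i < length ys \<and> xs ! i = ys ! e i"
proof -
  have "\<exists>e. strict_mono_on {..<length xs} e \<and>
    (\<forall>i<length xs. e i < length ys \<and> xs ! i = ys ! e i)"
    using assms
  proof (induction rule: list_emb.induct)
    case (list_emb_Nil ys)
    then show ?case by (simp add: strict_mono_on_def)
  next
    case (list_emb_Cons xs ys y)
    then obtain e where e: "strict_mono_on {..<length xs} e"
      "\<forall>i<length xs. e i < length ys \<and> xs ! i = ys ! e i" by blast
    then show ?case
      by (intro exI[of _ "Suc \<circ> e"]) (auto simp: strict_mono_on_def)
  next
    case (list_emb_Cons2 x y xs ys)
    then obtain e where e: "strict_mono_on {..<length xs} e"
      "\<forall>i<length xs. e i < length ys \<and> xs ! i = ys ! e i" by blast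
    \<comment> \<open>The matched heads are at position 0 on both sides, and the embedding of the
      tails is shifted by one.\<close>
    have "strict_mono_on {..<length (x # xs)} (case_nat 0 (Suc \<circ> e))"
      using e(1) by (auto simp: strict_mono_on_def split: nat.split)
    moreover have "\<forall>i<length (x # xs). case_nat 0 (Suc \<circ> e) i < length (y # ys) \<and>
        (x # xs) ! i = (y # ys) ! case_nat 0 (Suc \<circ> e) i"
      using e(2) list_emb_Cons2 by (auto split: nat.split)
    ultimately show ?case by blast
  qed
  then show ?thesis using that by blast
qed

text \<open>Embeddings are handled below as increasing maps of positions, because lines can be
  pulled back along such maps; \<open>containedI\<close> is the way back to subsequences.\<close>

lemma containedE:
  assumes "\<alpha> \<preceq> \<pi>"
  obtains e where "strict_mono_on {..<length \<alpha>} e" "\<And>i. i < length \<alpha> \<Longrightarrow> e i < length \<pi>"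
    "\<And>i j. i < length \<alpha> \<Longrightarrow> j < length \<alpha> \<Longrightarrow> \<alpha> ! i < \<alpha> ! j \<longleftrightarrow> \<pi> ! e i < \<pi> ! e j"
proof -
  obtain s where s: "subseq s \<pi>" "order_iso s \<alpha>"
    using assms by (auto simp: contained_def)
  obtain e where "strict_mono_on {..<length s} e"
    "\<And>i. i < length s \<Longrightarrow> e i < length \<pi> \<and> s ! i = \<pi> ! e i"
    using subseq_embedding[OF s(1)] by blast
  with s(2) show ?thesis
    by (intro that[of e]) (auto simp: order_iso_def)
qed

lemma containedI:
  assumes "strict_mono_on {..<length \<alpha>} e" "\<And>i. i < length \<alpha> \<Longrightarrow> e i < length \<pi>"
    "\<And>i j. i < length \<alpha> \<Longrightarrow> j < length \<alpha> \<Longrightarrow> \<alpha> ! i < \<alpha> ! j \<longleftrightarrow> \<pi> ! e i < \<pi> ! e j"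
  shows "\<alpha> \<preceq> \<pi>"
proof -
  \<comment> \<open>The chosen positions form a subsequence of all positions, and reading off the
    entries of \<open>\<pi>\<close> preserves this.\<close>
  have "subseq (map e [0..<length \<alpha>]) [0..<length \<pi>]"
    using assms(1,2)
    by (intro strict_sorted_subseq)
      (auto simp: sorted_wrt_map sorted_wrt_iff_nth_less strict_mono_on_def)
  then have "subseq (map ((!) \<pi>) (map e [0..<length \<alpha>])) (map ((!) \<pi>) [0..<length \<pi>])"
    by (rule subseq_map)
  then have "subseq (map (\<lambda>i. \<pi> ! e i) [0..<length \<alpha>]) \<pi>"
    by (simp add: map_nth o_def)
  moreover have "order_iso (map (\<lambda>i. \<pi> ! e i) [0..<length \<alpha>]) \<alpha>"
    using assms(3) by (simp add: order_iso_def)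
  ultimately show ?thesis
    by (auto simp: contained_def)
qed

lemma contained_order_iso_right:
  assumes "\<alpha> \<preceq> \<beta>" "order_iso \<beta> \<gamma>"
  shows "\<alpha> \<preceq> \<gamma>"
proof -
  obtain e where "strict_mono_on {..<length \<alpha>} e" "\<And>i. i < length \<alpha> \<Longrightarrow> e i < length \<beta>"
    "\<And>i j. i < length \<alpha> \<Longrightarrow> j < length \<alpha> \<Longrightarrow> \<alpha> ! i < \<alpha> ! j \<longleftrightarrow> \<beta> ! e i < \<beta> ! e j"
    using containedE[OF assms(1)] by blast
  then show ?thesis
    using assms(2) by (intro containedI[of \<alpha> e]) (auto simp: order_iso_def)
qed

lemma contained_order_iso_left:
  assumes "\<alpha> \<preceq> \<beta>" "order_iso \<alpha> \<gamma>"
  shows "\<gamma> \<preceq> \<beta>"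
proof -
  obtain s where "subseq s \<beta>" "order_iso s \<alpha>"
    using assms(1) by (auto simp: contained_def)
  moreover from this have "order_iso s \<gamma>"
    using assms(2) by (simp add: order_iso_def)
  ultimately show ?thesis
    by (auto simp: contained_def)
qed

lemma contained_refl: "\<pi> \<preceq> \<pi>"
  by (auto simp: contained_def order_iso_def)

lemma perms_iff: "\<pi> \<in> perms \<longleftrightarrow> distinct \<pi> \<and> set \<pi> = {..<length \<pi>}"
proof
  assume "\<pi> \<in> perms"
  then obtain n where n: "distinct \<pi>" "set \<pi> = {..<n}"
    by (auto simp: perms_def permutations_of_set_def)
  then have "length \<pi> = n"
    using distinct_card[of \<pi>] by simp
  with n show "distinct \<pi> \<and> set \<pi> = {..<length \<pi>}" by simp
next
  assume "distinct \<pi> \<and> set \<pi> = {..<length \<pi>}"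
  then show "\<pi> \<in> perms"
    unfolding perms_def permutations_of_set_def by blast
qed

lemma perm_nth_less: "\<pi> \<in> perms \<Longrightarrow> p < length \<pi> \<Longrightarrow> \<pi> ! p < length \<pi>"
  using nth_mem[of p \<pi>] by (auto simp: perms_iff simp del: nth_mem)

lemma perm_bij_betw: "\<pi> \<in> perms \<Longrightarrow> bij_betw ((!) \<pi>) {..<length \<pi>} {..<length \<pi>}"
  by (auto simp: perms_iff intro: bij_betw_nth)

text \<open>Standardization: each entry is replaced by its rank. A cell is a list of arbitrary
  distinct values, whereas the members of a class are permutations.\<close>

lemma order_iso_perm_exists:
  assumes "distinct xs"
  shows "\<exists>\<rho>\<in>perms. order_iso xs \<rho>"
proof -
  define rank where "rank = (\<lambda>x. card {y \<in> set xs. y < x})"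
  have less: "rank x < rank y" if "x \<in> set xs" "x < y" for x y
    unfolding rank_def using that by (intro psubset_card_mono) auto
  have less_iff: "rank x < rank y \<longleftrightarrow> x < y" if "x \<in> set xs" "y \<in> set xs" for x y
    using less[of x y] less[of y x] that by (cases x y rule: linorder_cases) auto
  have inj: "inj_on rank (set xs)"
    by (rule inj_onI) (metis less_iff less_irrefl linorder_neqE_nat)
  \<comment> \<open>No entry is counted in its own rank, so ranks stay below the number of entries;
    being distinct, they take every value below it.\<close>
  have "rank ` set xs \<subseteq> {..<card (set xs)}"
    unfolding rank_def by (auto intro!: psubset_card_mono)
  then have "rank ` set xs = {..<card (set xs)}"
    by (intro card_subset_eq) (auto simp: card_image[OF inj])
  then have "map rank xs \<in> perms"
    using assms inj by (simp add: perms_iff distinct_map distinct_card)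
  moreover have "order_iso xs (map rank xs)"
    using less_iff by (simp add: order_iso_def)
  ultimately show ?thesis by blast
qed


section \<open>Intervals between dividers\<close>

text \<open>The index of the column or row in which a coordinate lies. The number of intervals is
  recovered as \<open>length c - 1\<close>; the description denotes properly only for
  \<open>p\<close> below the last divider.\<close>

definition part :: "nat list \<Rightarrow> nat \<Rightarrow> nat" where
  "part c p = (THE i. i < length c - 1 \<and> p \<in> {c ! i..<c ! Suc i})"

lemma dividers_mono: "dividers m k c \<Longrightarrow> i \<le> j \<Longrightarrow> j \<le> m \<Longrightarrow> c ! i \<le> c ! j"
  by (auto simp: dividers_def intro: sorted_nth_mono)

lemma dividers_le: "dividers m k c \<Longrightarrow> i \<le> m \<Longrightarrow> c ! i \<le> k"
  using dividers_mono[of m k c i m] by (auto simp: dividers_def)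

lemma interval_unique:
  assumes "dividers m k c" "i < m" "p \<in> {c ! i..<c ! Suc i}" "j < m" "p \<in> {c ! j..<c ! Suc j}"
  shows "i = j"
  using assms dividers_mono[OF assms(1), of "Suc i" j] dividers_mono[OF assms(1), of "Suc j" i]
  by (cases i j rule: linorder_cases) auto

lemma part_eqI:
  assumes "dividers m k c" "i < m" "p \<in> {c ! i..<c ! Suc i}"
  shows "part c p = i"
  unfolding part_def
  using assms interval_unique[OF assms(1)] by (intro the_equality) (auto simp: dividers_def)

lemma part_bounds:
  assumes "dividers m k c" "p < k"
  shows "part c p < m" "p \<in> {c ! part c p..<c ! Suc (part c p)}"
proof -
  \<comment> \<open>\<open>Suc i\<close> is the index of the first divider beyond \<open>p\<close>;
    this choice passes over empty intervals.\<close>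
  have "\<exists>i<m. (\<forall>j\<le>i. \<not> p < c ! j) \<and> p < c ! Suc i"
    using assms by (intro ex_least_nat_less) (auto simp: dividers_def)
  then obtain i where i: "i < m" "p \<in> {c ! i..<c ! Suc i}"
    by (auto simp: not_less)
  with part_eqI[OF assms(1) i]
  show "part c p < m" "p \<in> {c ! part c p..<c ! Suc (part c p)}" by auto
qed

lemma part_eq_iff:
  assumes "dividers m k c" "p < k" "i < m"
  shows "part c p = i \<longleftrightarrow> p \<in> {c ! i..<c ! Suc i}"
  using part_bounds[OF assms(1,2)] part_eqI[OF assms(1,3), of p] by auto

lemma part_less_imp_less:
  assumes "dividers m k c" "p < k" "q < k" "part c p < part c q"
  shows "p < q"
  using part_bounds[OF assms(1,2)] part_bounds[OF assms(1,3)] assms(4)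
    dividers_mono[OF assms(1), of "Suc (part c p)" "part c q"] by auto

text \<open>Points in different intervals compare as the indices of the intervals do. Hence a map
  that keeps indices only has to be checked for order inside single intervals.\<close>

lemma less_via_part:
  assumes "dividers m k c" "dividers m' k' c'" "p < k" "q < k" "p' < k'" "q' < k'"
    and "part c p = part c' p'" "part c q = part c' q'"
    and "part c p = part c q \<Longrightarrow> p < q \<longleftrightarrow> p' < q'"
  shows "p < q \<longleftrightarrow> p' < q'"
  using assms part_less_imp_less[OF assms(1), of p q] part_less_imp_less[OF assms(1), of q p]
    part_less_imp_less[OF assms(2), of p' q'] part_less_imp_less[OF assms(2), of q' p']
  by (cases "part c p" "part c q" rule: linorder_cases) auto


section \<open>Gridded containment\<close>

text \<open>The order is only compared within columns and within rows: across columns and rows it is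
  determined by the indices of the columns and rows, and these comparisons are not invariant under
  grid mappings.\<close>

definition gridded_contained :: "gridded_perm \<Rightarrow> gridded_perm \<Rightarrow> bool" where
  "gridded_contained = (\<lambda>(\<pi>, c, r) (\<pi>', c', r'). \<exists>\<phi>.
     (\<forall>p<length \<pi>. \<phi> p < length \<pi>' \<and> part c' (\<phi> p) = part c p \<and>
        part r' (\<pi>' ! \<phi> p) = part r (\<pi> ! p)) \<and>
     (\<forall>p<length \<pi>. \<forall>q<length \<pi>. part c p = part c q \<longrightarrow> (p < q \<longleftrightarrow> \<phi> p < \<phi> q)) \<and>
     (\<forall>p<length \<pi>. \<forall>q<length \<pi>. part r (\<pi> ! p) = part r (\<pi> ! q) \<longrightarrow>
        (\<pi> ! p < \<pi> ! q \<longleftrightarrow> \<pi>' ! \<phi> p < \<pi>' ! \<phi> q)))"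

lemma gridded_containedE:
  assumes "gridded_contained (\<pi>, c, r) (\<pi>', c', r')"
  obtains \<phi> where "\<And>p. p < length \<pi> \<Longrightarrow> \<phi> p < length \<pi>' \<and> part c' (\<phi> p) = part c p \<and>
        part r' (\<pi>' ! \<phi> p) = part r (\<pi> ! p)"
    "\<And>p q. p < length \<pi> \<Longrightarrow> q < length \<pi> \<Longrightarrow> part c p = part c q \<Longrightarrow> p < q \<longleftrightarrow> \<phi> p < \<phi> q"
    "\<And>p q. p < length \<pi> \<Longrightarrow> q < length \<pi> \<Longrightarrow> part r (\<pi> ! p) = part r (\<pi> ! q) \<Longrightarrow>
        \<pi> ! p < \<pi> ! q \<longleftrightarrow> \<pi>' ! \<phi> p < \<pi>' ! \<phi> q"
proof -
  from assms obtain \<phi> where "\<forall>p<length \<pi>. \<phi> p < length \<pi>' \<and> part c' (\<phi> p) = part c p \<and>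
        part r' (\<pi>' ! \<phi> p) = part r (\<pi> ! p)"
    "\<forall>p<length \<pi>. \<forall>q<length \<pi>. part c p = part c q \<longrightarrow> (p < q \<longleftrightarrow> \<phi> p < \<phi> q)"
    "\<forall>p<length \<pi>. \<forall>q<length \<pi>. part r (\<pi> ! p) = part r (\<pi> ! q) \<longrightarrow>
        (\<pi> ! p < \<pi> ! q \<longleftrightarrow> \<pi>' ! \<phi> p < \<pi>' ! \<phi> q)"
    unfolding gridded_contained_def prod.case by (elim exE conjE)
  then show ?thesis
    by (intro that[of \<phi>]) blast+
qed

text \<open>What remains of \<open>is_gridded\<close> when the classes are forgotten; undoing a grid
  mapping refers to nothing more.\<close>

definition grid_shape :: "nat \<Rightarrow> nat \<Rightarrow> gridded_perm \<Rightarrow> bool" where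
  "grid_shape m n = (\<lambda>(\<pi>, c, r). \<pi> \<in> perms \<and>
     dividers m (length \<pi>) c \<and> dividers n (length \<pi>) r)"

lemma is_gridded_grid_shape: "is_gridded M g \<Longrightarrow> grid_shape (dim_col M) (dim_row M) g"
  by (auto simp: is_gridded_def grid_shape_def)

text \<open>The comparisons that \<open>gridded_contained\<close> leaves out, across columns and
  across rows, are recovered from the preserved indices by \<open>less_via_part\<close>.\<close>

lemma gridded_contained_imp_contained:
  assumes "grid_shape m n (\<pi>, c, r)" "grid_shape m' n' (\<pi>', c', r')"
    and "gridded_contained (\<pi>, c, r) (\<pi>', c', r')"
  shows "\<pi> \<preceq> \<pi>'"
proof -
  obtain \<phi> where \<phi>: "\<And>p. p < length \<pi> \<Longrightarrow> \<phi> p < length \<pi>' \<and> part c' (\<phi> p) = part c p \<and>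
        part r' (\<pi>' ! \<phi> p) = part r (\<pi> ! p)"
    and col: "\<And>p q. p < length \<pi> \<Longrightarrow> q < length \<pi> \<Longrightarrow> part c p = part c q \<Longrightarrow> p < q \<longleftrightarrow> \<phi> p < \<phi> q"
    and row: "\<And>p q. p < length \<pi> \<Longrightarrow> q < length \<pi> \<Longrightarrow> part r (\<pi> ! p) = part r (\<pi> ! q) \<Longrightarrow>
        \<pi> ! p < \<pi> ! q \<longleftrightarrow> \<pi>' ! \<phi> p < \<pi>' ! \<phi> q"
    using gridded_containedE[OF assms(3)] by blast
  have shape: "\<pi> \<in> perms" "dividers m (length \<pi>) c" "dividers n (length \<pi>) r"
    "\<pi>' \<in> perms" "dividers m' (length \<pi>') c'" "dividers n' (length \<pi>') r'"
    using assms(1,2) by (auto simp: grid_shape_def)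
  have "p < q \<longleftrightarrow> \<phi> p < \<phi> q" if "p < length \<pi>" "q < length \<pi>" for p q
    by (rule less_via_part[OF shape(2,5) that]) (simp_all add: that \<phi> col)
  moreover have "\<pi> ! p < \<pi> ! q \<longleftrightarrow> \<pi>' ! \<phi> p < \<pi>' ! \<phi> q" if "p < length \<pi>" "q < length \<pi>" for p q
    by (rule less_via_part[OF shape(3,6)])
      (simp_all add: that \<phi> row perm_nth_less[OF shape(1)] perm_nth_less[OF shape(4)])
  ultimately show ?thesis
    using \<phi> by (intro containedI[of \<pi> \<phi>]) (auto simp: strict_mono_on_def)
qed

section \<open>Pulling a gridding back along an embedding\<close>

definition pull_dividers :: "nat \<Rightarrow> (nat \<Rightarrow> nat) \<Rightarrow> nat list \<Rightarrow> nat list" where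
  "pull_dividers k e c = map (\<lambda>t. card {p. p < k \<and> e p < t}) c"

text \<open>As \<open>e\<close> is increasing, the points sent below a line form an initial segment,
  so their number is the place of the pulled-back line. The proof compares this segment with
  \<open>{..p}\<close> and \<open>{..<p}\<close>.\<close>

lemma pull_dividers_less_iff:
  assumes "strict_mono_on {..<k} e" "i < length c" "p < k"
  shows "p < pull_dividers k e c ! i \<longleftrightarrow> e p < c ! i"
proof -
  let ?S = "{q. q < k \<and> e q < c ! i}"
  have mono: "e q \<le> e q'" if "q \<le> q'" "q' < k" for q q'
    using strict_mono_on_leD[OF assms(1), of q q'] that by simp
  have "p < card ?S" if "e p < c ! i"
  proof -
    have "{..p} \<subseteq> ?S"
    proof
      fix q assume "q \<in> {..p}"
      then show "q \<in> ?S"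
        using mono[of q p] assms(3) that by simp
    qed
    then have "card {..p} \<le> card ?S"
      by (intro card_mono) simp_all
    then show ?thesis by simp
  qed
  moreover have "card ?S \<le> p" if "c ! i \<le> e p"
  proof -
    have "?S \<subseteq> {..<p}"
    proof
      fix q assume "q \<in> ?S"
      then show "q \<in> {..<p}"
        using mono[of p q] that by (cases "p \<le> q") auto
    qed
    then have "card ?S \<le> card {..<p}"
      by (intro card_mono) simp_all
    then show ?thesis by simp
  qed
  ultimately have "p < card ?S \<longleftrightarrow> e p < c ! i"
    by (meson not_le)
  then show ?thesis
    using assms(2) by (simp add: pull_dividers_def)
qed

lemma pull_dividers_interval:
  assumes "strict_mono_on {..<k} e" "Suc i < length c" "p < k"
  shows "p \<in> {pull_dividers k e c ! i..<pull_dividers k e c ! Suc i} \<longleftrightarrow> e p \<in> {c ! i..<c ! Suc i}"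
  using pull_dividers_less_iff[OF assms(1) _ assms(3), of i c]
    pull_dividers_less_iff[OF assms(1) _ assms(3), of "Suc i" c] assms(2)
  by (simp flip: not_less)

lemma dividers_pull:
  assumes "dividers m n c" "\<And>p. p < k \<Longrightarrow> e p < n"
  shows "dividers m k (pull_dividers k e c)"
proof -
  have "card {p. p < k \<and> e p < t} \<le> card {p. p < k \<and> e p < u}" if "t \<le> u" for t u
    using that by (intro card_mono) auto
  then have "sorted (pull_dividers k e c)"
    using assms(1) unfolding pull_dividers_def dividers_def
    by (auto simp: sorted_iff_nth_mono)
  \<comment> \<open>All \<open>k\<close> points are sent below \<open>n\<close>, so the last divider
    pulls back to \<open>k\<close>; nothing lies below the first divider, which stays
    \<open>0\<close>.\<close>
  moreover have "{p. p < k \<and> e p < n} = {..<k}"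
    using assms(2) by auto
  ultimately show ?thesis
    using assms(1) by (auto simp: dividers_def pull_dividers_def)
qed

text \<open>Describes a cell through its positions, on which an embedding acts.\<close>

lemma cell_eq: "cell (\<pi>, c, r) i j =
    map ((!) \<pi>) (filter (\<lambda>p. \<pi> ! p \<in> {r ! j..<r ! Suc j}) [c ! i..<c ! Suc i])"
  by (simp add: cell_def column_part_def filter_map o_def)

text \<open>The lines of \<open>\<sigma>\<close> are pulled back along an embedding. Each resulting
  cell of \<open>\<pi>\<close> embeds in the corresponding cell of \<open>\<sigma>\<close>, and
  classes are closed downwards, so this is an \<open>N\<close>-gridding of \<open>\<pi>\<close>;
  uniqueness identifies it with \<open>(c, r)\<close>.\<close>

lemma contained_imp_gridded_contained:
  assumes N: "gridding_matrix N" and g: "uniquely_gridded N (\<pi>, c, r)"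
    and h: "is_gridded N (\<sigma>, d, s)" and "\<pi> \<preceq> \<sigma>"
  shows "gridded_contained (\<pi>, c, r) (\<sigma>, d, s)"
proof -
  let ?k = "length \<pi>"
  let ?m = "dim_col N" and ?n = "dim_row N"
  obtain e where e: "strict_mono_on {..<?k} e" "\<And>p. p < ?k \<Longrightarrow> e p < length \<sigma>"
    and ord: "\<And>p q. p < ?k \<Longrightarrow> q < ?k \<Longrightarrow> \<pi> ! p < \<pi> ! q \<longleftrightarrow> \<sigma> ! e p < \<sigma> ! e q"
    using containedE[OF \<open>\<pi> \<preceq> \<sigma>\<close>] by blast
  have perms: "\<pi> \<in> perms" "\<sigma> \<in> perms"
    and div: "dividers ?m (length \<sigma>) d" "dividers ?n (length \<sigma>) s"
    using g h by (auto simp: uniquely_gridded_def is_gridded_def)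
  \<comment> \<open>The embedding read on values: the value at \<open>p\<close> goes to the value at
    \<open>e p\<close>. It is increasing, so rows can be pulled back along \<open>w\<close> as
    columns are along \<open>e\<close>.\<close>
  define w where "w = (\<lambda>v. \<sigma> ! e (inv_into {..<?k} ((!) \<pi>) v))"
  have w: "w (\<pi> ! p) = \<sigma> ! e p" if "p < ?k" for p
    using perm_bij_betw[OF perms(1)] that by (simp add: w_def bij_betw_inv_into_left)
  have preim: "\<exists>p<?k. v = \<pi> ! p" if "v < ?k" for v
    using perm_bij_betw[OF perms(1)] that by (auto simp: bij_betw_def)
  have w_mono: "strict_mono_on {..<?k} w"
    unfolding strict_mono_on_def using preim w ord by (metis lessThan_iff)
  have w_less: "w v < length \<sigma>" if "v < ?k" for v
    using preim[OF that] w e(2) perm_nth_less[OF perms(2)] by auto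
  define c' r' where "c' = pull_dividers ?k e d" and "r' = pull_dividers ?k w s"
  have div': "dividers ?m ?k c'" "dividers ?n ?k r'"
    unfolding c'_def r'_def using dividers_pull div e(2) w_less by blast+
  have col: "p \<in> {c' ! i..<c' ! Suc i} \<longleftrightarrow> e p \<in> {d ! i..<d ! Suc i}" if "p < ?k" "i < ?m" for p i
    unfolding c'_def using that div(1) by (intro pull_dividers_interval e) (auto simp: dividers_def)
  have row: "\<pi> ! p \<in> {r' ! j..<r' ! Suc j} \<longleftrightarrow> \<sigma> ! e p \<in> {s ! j..<s ! Suc j}"
    if "p < ?k" "j < ?n" for p j
    unfolding r'_def w[OF that(1), symmetric]
    using that div(2) perm_nth_less[OF perms(1)] w_mono
    by (intro pull_dividers_interval) (auto simp: dividers_def)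
  have "cell (\<pi>, c', r') i j = [] \<or> (\<exists>\<rho>\<in>N $$ (j, i). order_iso (cell (\<pi>, c', r') i j) \<rho>)"
    if ij: "i < ?m" "j < ?n" for i j
  proof (cases "cell (\<pi>, c', r') i j = []")
    case False
    define P Q where "P = filter (\<lambda>p. \<pi> ! p \<in> {r' ! j..<r' ! Suc j}) [c' ! i..<c' ! Suc i]"
      and "Q = filter (\<lambda>p. \<sigma> ! p \<in> {s ! j..<s ! Suc j}) [d ! i..<d ! Suc i]"
    have cell_P: "cell (\<pi>, c', r') i j = map ((!) \<pi>) P"
      and cell_Q: "cell (\<sigma>, d, s) i j = map ((!) \<sigma>) Q"
      unfolding P_def Q_def by (rule cell_eq)+
    have less: "p < ?k" if "p \<in> set P" for p
      using that dividers_le[OF div'(1), of "Suc i"] ij by (auto simp: P_def)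
    \<comment> \<open>The pulled-back lines are placed so that a point lies in cell
      \<open>i j\<close> exactly if its image does.\<close>
    have sub: "e ` set P \<subseteq> set Q"
    proof safe
      fix p assume p: "p \<in> set P"
      then have "p \<in> {c' ! i..<c' ! Suc i}" "\<pi> ! p \<in> {r' ! j..<r' ! Suc j}"
        by (auto simp: P_def)
      then show "e p \<in> set Q"
        using col[OF less[OF p] ij(1)] row[OF less[OF p] ij(2)] by (simp add: Q_def)
    qed
    have "sorted_wrt (<) P" "sorted_wrt (<) Q"
      unfolding P_def Q_def by (simp_all add: sorted_wrt_filter)
    moreover have "sorted_wrt (\<lambda>p q. e p < e q) P"
      by (rule sorted_wrt_mono_rel[OF _ \<open>sorted_wrt (<) P\<close>])
        (use e(1) less in \<open>simp add: strict_mono_on_def\<close>)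
    then have "sorted_wrt (<) (map e P)"
      by (simp add: sorted_wrt_map)
    ultimately have "subseq (map e P) Q"
      using sub by (intro strict_sorted_subseq) auto
    then have "subseq (map ((!) \<sigma>) (map e P)) (map ((!) \<sigma>) Q)"
      by (rule subseq_map)
    moreover have "order_iso (map ((!) \<sigma>) (map e P)) (map ((!) \<pi>) P)"
      using ord less by (simp add: order_iso_def)
    ultimately have sub_cell: "cell (\<pi>, c', r') i j \<preceq> cell (\<sigma>, d, s) i j"
      unfolding cell_P cell_Q contained_def by blast
    \<comment> \<open>Excludes that this cell is admissible merely by being empty, so that a member
      \<open>\<tau>\<close> of the class is available.\<close>
    have "cell (\<sigma>, d, s) i j \<noteq> []"
      using False sub unfolding cell_P cell_Q by auto
    then obtain \<tau> where \<tau>: "\<tau> \<in> N $$ (j, i)" "order_iso (cell (\<sigma>, d, s) i j) \<tau>"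
      using h ij by (auto simp: is_gridded_def)
    have "distinct (cell (\<pi>, c', r') i j)"
      using \<open>sorted_wrt (<) P\<close> perms(1) less unfolding cell_P
      by (auto simp: strict_sorted_iff distinct_map perms_iff inj_on_def nth_eq_iff_index_eq)
    then obtain \<rho> where \<rho>: "\<rho> \<in> perms" "order_iso (cell (\<pi>, c', r') i j) \<rho>"
      using order_iso_perm_exists by blast
    \<comment> \<open>\<open>\<rho>\<close> and \<open>\<tau>\<close> are the standardizations of
      the two cells; downward closure passes membership from \<open>\<tau>\<close> to
      \<open>\<rho>\<close>.\<close>
    have "\<rho> \<preceq> \<tau>"
      using sub_cell \<tau>(2) \<rho>(2) contained_order_iso_left contained_order_iso_right by blast
    then have "\<rho> \<in> N $$ (j, i)"
      using N ij \<tau>(1) \<rho>(1) by (auto simp: gridding_matrix_def perm_class_def)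
    with \<rho>(2) show ?thesis by blast
  qed simp
  then have "is_gridded N (\<pi>, c', r')"
    using perms div' by (auto simp: is_gridded_def)
  with g have eq: "c' = c" "r' = r"
    by (auto simp: uniquely_gridded_def)
  have "part d (e p) = part c p" if "p < ?k" for p
    using part_bounds[OF div'(1) that] col[OF that, of "part c' p"] unfolding eq
    by (intro part_eqI[OF div(1)]) auto
  moreover have "part s (\<sigma> ! e p) = part r (\<pi> ! p)" if "p < ?k" for p
    using part_bounds[OF div'(2) perm_nth_less[OF perms(1) that]]
      row[OF that, of "part r' (\<pi> ! p)"] unfolding eq
    by (intro part_eqI[OF div(2)]) auto
  moreover have "p < q \<longleftrightarrow> e p < e q" if "p < ?k" "q < ?k" for p q
    using strict_mono_on_less[OF e(1), of p q] that by simp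
  ultimately show ?thesis
    unfolding gridded_contained_def prod.case using e(2) ord by (intro exI[of _ e]) blast
qed


section \<open>Grid mappings reflect gridded containment\<close>

text \<open>A map \<open>\<tau>\<close> from new to old coordinates: the \<open>i\<close>th new interval is the \<open>\<mu> i\<close>th old one, reversed
  if \<open>i \<in> R\<close>.\<close>

definition rearranges ::
  "nat \<Rightarrow> nat \<Rightarrow> (nat \<Rightarrow> nat) \<Rightarrow> nat set \<Rightarrow> nat list \<Rightarrow> nat list \<Rightarrow> (nat \<Rightarrow> nat) \<Rightarrow> bool" where
  "rearranges m k \<mu> R c' c \<tau> \<longleftrightarrow> inj_on \<mu> {..<m} \<and> dividers m k c' \<and> (\<forall>p<k. \<tau> p < k \<and>
     part c (\<tau> p) = \<mu> (part c' p)) \<and>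
     (\<forall>p<k. \<forall>q<k. part c' p = part c' q \<longrightarrow>
       (p < q \<longleftrightarrow> (if part c' p \<in> R then \<tau> q < \<tau> p else \<tau> p < \<tau> q)))"

lemma rearranges_part_eq_iff:
  assumes "rearranges m k \<mu> R c' c \<tau>" "p < k" "q < k"
  shows "part c (\<tau> p) = part c (\<tau> q) \<longleftrightarrow> part c' p = part c' q"
  using assms part_bounds(1)[of m k c'] by (auto simp: rearranges_def inj_on_def)

text \<open>Points with equal images lie in the same interval, where \<open>\<tau>\<close> strictly
  preserves or strictly reverses the order. So \<open>\<tau>\<close> is injective, and an injective
  self-map of a finite set is onto.\<close>

lemma rearranges_surj:
  assumes "rearranges m k \<mu> R c' c \<tau>" "p < k"
  shows "\<exists>q<k. \<tau> q = p"
proof -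
  have "inj_on \<tau> {..<k}"
  proof (rule inj_onI)
    fix p q assume *: "p \<in> {..<k}" "q \<in> {..<k}" "\<tau> p = \<tau> q"
    then have "part c' p = part c' q"
      using rearranges_part_eq_iff[OF assms(1), of p q] by simp
    with * assms(1) show "p = q"
      unfolding rearranges_def by (metis less_irrefl lessThan_iff linorder_neqE_nat)
  qed
  moreover have "\<tau> ` {..<k} \<subseteq> {..<k}"
    using assms(1) by (auto simp: rearranges_def)
  ultimately have "\<tau> ` {..<k} = {..<k}"
    by (simp add: endo_inj_surj)
  with assms(2) show ?thesis by (auto simp: image_iff) (metis lessThan_iff imageE)
qed

text \<open>Reflection of the half-open interval from \<open>a\<close> to \<open>b\<close> is
  \<open>a + b - Suc p\<close>, which exchanges \<open>a\<close> and \<open>b - 1\<close>. It serves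
  positions under column reversal and values under row complement alike.\<close>

lemma rearranges_reverse:
  assumes "dividers m k c" "i < m"
  shows "rearranges m k id {i} c c (\<lambda>p. if p \<in> {c ! i..<c ! Suc i} then c ! i + c ! Suc i - Suc p else p)"
proof -
  let ?\<tau> = "\<lambda>p. if p \<in> {c ! i..<c ! Suc i} then c ! i + c ! Suc i - Suc p else p"
  have "c ! Suc i \<le> k"
    using dividers_le[OF assms(1), of "Suc i"] assms(2) by simp
  moreover have "part c p = i \<and> part c (c ! i + c ! Suc i - Suc p) = i"
    if "p \<in> {c ! i..<c ! Suc i}" for p
    using that by (intro conjI part_eqI[OF assms]) auto
  ultimately have "?\<tau> p < k \<and> part c (?\<tau> p) = part c p" if "p < k" for p
    using that by auto
  moreover have "p < q \<longleftrightarrow> (if part c p \<in> {i} then ?\<tau> q < ?\<tau> p else ?\<tau> p < ?\<tau> q)"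
    if "p < k" "q < k" "part c p = part c q" for p q
  proof -
    have "p \<in> {c ! i..<c ! Suc i} \<longleftrightarrow> part c p = i" "q \<in> {c ! i..<c ! Suc i} \<longleftrightarrow> part c p = i"
      unfolding part_eq_iff[OF assms(1) _ assms(2), symmetric, OF that(1)]
        part_eq_iff[OF assms(1) _ assms(2), symmetric, OF that(2)] that(3) by (rule refl)+
    then show ?thesis
      by (cases "part c p = i") auto
  qed
  ultimately show ?thesis
    using assms(1) inj_on_id[of "{..<m}"] unfolding rearranges_def id_apply by blast
qed

lemma permute_dividers_nth:
  "i < length c \<Longrightarrow> permute_dividers \<mu> c ! i = (\<Sum>k<i. c ! Suc (\<mu> k) - c ! \<mu> k)"
  by (simp add: permute_dividers_def)

text \<open>Each new interval is translated onto the old one with index \<open>\<mu> i\<close>,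
  keeping the offset from its lower end. That the permuted list is again a list of dividers is later
  read off from the shape of the image.\<close>

lemma rearranges_permute:
  assumes "dividers m k c" "\<mu> permutes {..<m}" "dividers m k (permute_dividers \<mu> c)"
  shows "rearranges m k \<mu> {} (permute_dividers \<mu> c) c
    (\<lambda>p. c ! \<mu> (part (permute_dividers \<mu> c) p) + (p - permute_dividers \<mu> c ! part (permute_dividers \<mu> c) p))"
    (is "rearranges m k \<mu> {} ?c' c ?\<tau>")
proof -
  have "?\<tau> p < k \<and> part c (?\<tau> p) = \<mu> (part ?c' p)" if "p < k" for p
  proof -
    define i where "i = part ?c' p"
    have i: "i < m" "?c' ! i \<le> p" "p < ?c' ! Suc i"
      using part_bounds[OF assms(3) that] by (auto simp: i_def)
    \<comment> \<open>Consecutive partial sums differ by the length of the old interval, so the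
      offset of \<open>p\<close> fits into that interval.\<close>
    have "?c' ! Suc i = ?c' ! i + (c ! Suc (\<mu> i) - c ! \<mu> i)"
      using i(1) assms(1) by (simp add: permute_dividers_nth dividers_def)
    with i have "c ! \<mu> i + (p - ?c' ! i) \<in> {c ! \<mu> i..<c ! Suc (\<mu> i)}"
      by auto
    moreover have "\<mu> i < m"
      using i(1) permutes_in_image[OF assms(2), of i] by simp
    ultimately show ?thesis
      using part_eqI[OF assms(1)] dividers_le[OF assms(1), of "Suc (\<mu> i)"]
      unfolding i_def[symmetric] by auto
  qed
  moreover have "p < q \<longleftrightarrow> ?\<tau> p < ?\<tau> q" if "p < k" "q < k" "part ?c' p = part ?c' q" for p q
    using part_bounds[OF assms(3) that(1)] part_bounds[OF assms(3) that(2)] that(3) by auto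
  ultimately show ?thesis
    using assms(3) permutes_inj_on[OF assms(2), of "{..<m}"]
    unfolding rearranges_def empty_iff if_False by blast
qed

text \<open>The old embedding is the new one conjugated: from old to new positions of
  \<open>\<pi>\<close>, along \<open>\<phi>\<close>, then back to old positions of
  \<open>\<sigma>\<close>. Both sides use the same \<open>\<mu>\<close> and \<open>R\<close>, so
  column indices agree and reversals cancel.\<close>

lemma gridded_contained_rearrange_columns:
  assumes "gridded_contained (\<pi>', c', r) (\<sigma>', d', s)"
    and "length \<pi>' = length \<pi>" "length \<sigma>' = length \<sigma>"
    and "rearranges m (length \<pi>) \<mu> R c' c \<tau>" "rearranges m (length \<sigma>) \<mu> R d' d \<upsilon>"
    and "\<And>p. p < length \<pi> \<Longrightarrow> \<pi>' ! p = \<pi> ! \<tau> p" "\<And>p. p < length \<sigma> \<Longrightarrow> \<sigma>' ! p = \<sigma> ! \<upsilon> p"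
  shows "gridded_contained (\<pi>, c, r) (\<sigma>, d, s)"
proof -
  obtain \<phi> where \<phi>: "\<And>p. p < length \<pi> \<Longrightarrow> \<phi> p < length \<sigma> \<and> part d' (\<phi> p) = part c' p \<and>
        part s (\<sigma>' ! \<phi> p) = part r (\<pi>' ! p)"
    and col: "\<And>p q. p < length \<pi> \<Longrightarrow> q < length \<pi> \<Longrightarrow> part c' p = part c' q \<Longrightarrow> p < q \<longleftrightarrow> \<phi> p < \<phi> q"
    and row: "\<And>p q. p < length \<pi> \<Longrightarrow> q < length \<pi> \<Longrightarrow> part r (\<pi>' ! p) = part r (\<pi>' ! q) \<Longrightarrow>
        \<pi>' ! p < \<pi>' ! q \<longleftrightarrow> \<sigma>' ! \<phi> p < \<sigma>' ! \<phi> q"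
    using gridded_containedE[OF assms(1), unfolded assms(2,3)] by blast
  \<comment> \<open>\<open>\<theta>\<close> passes from old to new positions, against the direction
    of \<open>\<tau>\<close>.\<close>
  obtain \<theta> where \<theta>: "\<And>p. p < length \<pi> \<Longrightarrow> \<theta> p < length \<pi> \<and> \<tau> (\<theta> p) = p"
    using rearranges_surj[OF assms(4)] by metis
  have col_eq: "part c p = part c q \<longleftrightarrow> part c' (\<theta> p) = part c' (\<theta> q)"
    if "p < length \<pi>" "q < length \<pi>" for p q
    using rearranges_part_eq_iff[OF assms(4), of "\<theta> p" "\<theta> q"] \<theta> that by simp
  have val: "\<pi>' ! \<theta> p = \<pi> ! p" "\<sigma>' ! \<phi> (\<theta> p) = \<sigma> ! \<upsilon> (\<phi> (\<theta> p))" if "p < length \<pi>" for p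
    using assms(6)[of "\<theta> p"] assms(7)[of "\<phi> (\<theta> p)"] \<theta>[OF that] \<phi>[of "\<theta> p"] by auto
  have \<tau>: "part c p = \<mu> (part c' (\<theta> p))" if "p < length \<pi>" for p
    using assms(4) \<theta>[OF that] unfolding rearranges_def by metis
  have \<upsilon>: "\<upsilon> p < length \<sigma>" "part d (\<upsilon> p) = \<mu> (part d' p)" if "p < length \<sigma>" for p
    using assms(5) that unfolding rearranges_def by blast+
  have "p < q \<longleftrightarrow> \<upsilon> (\<phi> (\<theta> p)) < \<upsilon> (\<phi> (\<theta> q))"
    if *: "p < length \<pi>" "q < length \<pi>" "part c p = part c q" for p q
  proof -
    have same: "part c' (\<theta> p) = part c' (\<theta> q)"
      using col_eq * by simp
    have old: "x < y \<longleftrightarrow> (if part c' (\<theta> x) \<in> R then \<theta> y < \<theta> x else \<theta> x < \<theta> y)"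
      if "x < length \<pi>" "y < length \<pi>" "part c' (\<theta> x) = part c' (\<theta> y)" for x y
      using assms(4) \<theta>[OF that(1)] \<theta>[OF that(2)] that(3) unfolding rearranges_def by metis
    have new: "\<upsilon> x < \<upsilon> y \<longleftrightarrow> (if part d' x \<in> R then y < x else x < y)"
      if "x < length \<sigma>" "y < length \<sigma>" "part d' x = part d' y" for x y
      using assms(5) that unfolding rearranges_def by metis
    show ?thesis
      using old[OF *(1,2) same] new[of "\<phi> (\<theta> p)" "\<phi> (\<theta> q)"] same
        \<phi>[of "\<theta> p"] \<phi>[of "\<theta> q"] \<theta>[OF *(1)] \<theta>[OF *(2)] col[of "\<theta> p" "\<theta> q"] col[of "\<theta> q" "\<theta> p"]
      by simp
  qed
  moreover have "\<pi> ! p < \<pi> ! q \<longleftrightarrow> \<sigma> ! \<upsilon> (\<phi> (\<theta> p)) < \<sigma> ! \<upsilon> (\<phi> (\<theta> q))"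
    if "p < length \<pi>" "q < length \<pi>" "part r (\<pi> ! p) = part r (\<pi> ! q)" for p q
    using row[of "\<theta> p" "\<theta> q"] \<theta> that val by simp
  moreover have "\<upsilon> (\<phi> (\<theta> p)) < length \<sigma>" "part d (\<upsilon> (\<phi> (\<theta> p))) = part c p"
    "part s (\<sigma> ! \<upsilon> (\<phi> (\<theta> p))) = part r (\<pi> ! p)" if "p < length \<pi>" for p
    using \<phi>[of "\<theta> p"] \<theta>[OF that] \<tau>[OF that] \<upsilon> val[OF that] by auto
  ultimately show ?thesis
    unfolding gridded_contained_def prod.case
    by (intro exI[of _ "\<lambda>p. \<upsilon> (\<phi> (\<theta> p))"]) blast
qed

text \<open>Here positions do not move, so \<open>\<phi>\<close> itself is the old embedding; only
  its effect on values is translated, by \<open>\<tau>\<close> and \<open>\<upsilon>\<close>.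
  Reversals cancel as for columns.\<close>

lemma gridded_contained_rearrange_rows:
  assumes "gridded_contained (\<pi>', c, r') (\<sigma>', d, s')"
    and "length \<pi>' = length \<pi>" "length \<sigma>' = length \<sigma>" "\<pi>' \<in> perms" "\<sigma>' \<in> perms"
    and "rearranges n (length \<pi>) \<nu> R r' r \<tau>" "rearranges n (length \<sigma>) \<nu> R s' s \<upsilon>"
    and "\<And>p. p < length \<pi> \<Longrightarrow> \<tau> (\<pi>' ! p) = \<pi> ! p" "\<And>p. p < length \<sigma> \<Longrightarrow> \<upsilon> (\<sigma>' ! p) = \<sigma> ! p"
  shows "gridded_contained (\<pi>, c, r) (\<sigma>, d, s)"
proof -
  obtain \<phi> where \<phi>: "\<And>p. p < length \<pi> \<Longrightarrow> \<phi> p < length \<sigma> \<and> part d (\<phi> p) = part c p \<and>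
        part s' (\<sigma>' ! \<phi> p) = part r' (\<pi>' ! p)"
    and col: "\<And>p q. p < length \<pi> \<Longrightarrow> q < length \<pi> \<Longrightarrow> part c p = part c q \<Longrightarrow> p < q \<longleftrightarrow> \<phi> p < \<phi> q"
    and row: "\<And>p q. p < length \<pi> \<Longrightarrow> q < length \<pi> \<Longrightarrow> part r' (\<pi>' ! p) = part r' (\<pi>' ! q) \<Longrightarrow>
        \<pi>' ! p < \<pi>' ! q \<longleftrightarrow> \<sigma>' ! \<phi> p < \<sigma>' ! \<phi> q"
    using gridded_containedE[OF assms(1), unfolded assms(2,3)] by blast
  have less: "\<pi>' ! p < length \<pi>" if "p < length \<pi>" for p
    using perm_nth_less[OF assms(4), of p] that by (simp add: assms(2))
  have less': "\<sigma>' ! p < length \<sigma>" if "p < length \<sigma>" for p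
    using perm_nth_less[OF assms(5), of p] that by (simp add: assms(3))
  have "part s (\<sigma> ! \<phi> p) = part r (\<pi> ! p)" if p: "p < length \<pi>" for p
  proof -
    have "part s (\<upsilon> (\<sigma>' ! \<phi> p)) = \<nu> (part s' (\<sigma>' ! \<phi> p))"
      using assms(7) \<phi>[OF p] less' unfolding rearranges_def by blast
    moreover have "part r (\<tau> (\<pi>' ! p)) = \<nu> (part r' (\<pi>' ! p))"
      using assms(6) less p unfolding rearranges_def by blast
    ultimately show ?thesis
      using \<phi>[OF p] assms(8)[OF p] assms(9)[of "\<phi> p"] by simp
  qed
  moreover have "\<pi> ! p < \<pi> ! q \<longleftrightarrow> \<sigma> ! \<phi> p < \<sigma> ! \<phi> q"
    if *: "p < length \<pi>" "q < length \<pi>" "part r (\<pi> ! p) = part r (\<pi> ! q)" for p q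
  proof -
    have same: "part r' (\<pi>' ! p) = part r' (\<pi>' ! q)"
      using rearranges_part_eq_iff[OF assms(6) less less, of p q] * assms(8) by simp
    have "\<tau> x < \<tau> y \<longleftrightarrow> (if part r' x \<in> R then y < x else x < y)"
      if "x < length \<pi>" "y < length \<pi>" "part r' x = part r' y" for x y
      using assms(6) that unfolding rearranges_def by metis
    from this[of "\<pi>' ! p" "\<pi>' ! q"]
    have "\<pi> ! p < \<pi> ! q \<longleftrightarrow> (if part r' (\<pi>' ! p) \<in> R then \<pi>' ! q < \<pi>' ! p else \<pi>' ! p < \<pi>' ! q)"
      using less * same assms(8) by simp
    moreover have "\<upsilon> x < \<upsilon> y \<longleftrightarrow> (if part s' x \<in> R then y < x else x < y)"
      if "x < length \<sigma>" "y < length \<sigma>" "part s' x = part s' y" for x y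
      using assms(7) that unfolding rearranges_def by metis
    from this[of "\<sigma>' ! \<phi> p" "\<sigma>' ! \<phi> q"]
    have "\<sigma> ! \<phi> p < \<sigma> ! \<phi> q \<longleftrightarrow>
      (if part r' (\<pi>' ! p) \<in> R then \<sigma>' ! \<phi> q < \<sigma>' ! \<phi> p else \<sigma>' ! \<phi> p < \<sigma>' ! \<phi> q)"
      using less' * same \<phi>[of p] \<phi>[of q] assms(9) by simp
    ultimately show ?thesis
      using row[of p q] row[of q p] * same by simp
  qed
  ultimately show ?thesis
    unfolding gridded_contained_def prod.case using \<phi> col by (intro exI[of _ \<phi>]) blast
qed

section \<open>Undoing a grid inverse\<close>

lemma perm_inverse_nth:
  assumes "\<pi> \<in> perms" "v < length \<pi>"
  shows "perm_inverse \<pi> ! v < length \<pi>" "\<pi> ! (perm_inverse \<pi> ! v) = v"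
  using perm_bij_betw[OF assms(1)] assms(2)
    inv_into_into[of v "(!) \<pi>" "{..<length \<pi>}"] bij_betw_inv_into_right[of "(!) \<pi>" "{..<length \<pi>}"]
  by (auto simp: perm_inverse_def bij_betw_def simp del: lessThan_iff)

lemma perm_inverse_nth_nth:
  assumes "\<pi> \<in> perms" "p < length \<pi>"
  shows "perm_inverse \<pi> ! (\<pi> ! p) = p"
  using perm_bij_betw[OF assms(1)] perm_nth_less[OF assms] assms(2)
  by (simp add: perm_inverse_def bij_betw_inv_into_left)

text \<open>A position in the inverse is a value of \<open>\<pi>\<close>. So \<open>\<phi>\<close>
  is applied to the value at \<open>p\<close>, and the inverse of \<open>\<sigma>\<close> turns the
  result into a position; the conditions on rows and columns change places.\<close>

lemma gridded_contained_inverse: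
  assumes "gridded_contained (perm_inverse \<pi>, r, c) (perm_inverse \<sigma>, s, d)"
    and "\<pi> \<in> perms" "\<sigma> \<in> perms"
  shows "gridded_contained (\<pi>, c, r) (\<sigma>, d, s)"
proof -
  have len: "length (perm_inverse \<rho>) = length \<rho>" for \<rho>
    by (simp add: perm_inverse_def)
  obtain \<phi> where \<phi>: "\<And>p. p < length \<pi> \<Longrightarrow> \<phi> p < length \<sigma> \<and> part s (\<phi> p) = part r p \<and>
        part d (perm_inverse \<sigma> ! \<phi> p) = part c (perm_inverse \<pi> ! p)"
    and col: "\<And>p q. p < length \<pi> \<Longrightarrow> q < length \<pi> \<Longrightarrow> part r p = part r q \<Longrightarrow> p < q \<longleftrightarrow> \<phi> p < \<phi> q"
    and row: "\<And>p q. p < length \<pi> \<Longrightarrow> q < length \<pi> \<Longrightarrow>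
        part c (perm_inverse \<pi> ! p) = part c (perm_inverse \<pi> ! q) \<Longrightarrow>
        perm_inverse \<pi> ! p < perm_inverse \<pi> ! q \<longleftrightarrow> perm_inverse \<sigma> ! \<phi> p < perm_inverse \<sigma> ! \<phi> q"
    using gridded_containedE[OF assms(1), unfolded len] by blast
  have *: "\<pi> ! p < length \<pi>" "perm_inverse \<pi> ! (\<pi> ! p) = p" "\<phi> (\<pi> ! p) < length \<sigma>"
    "perm_inverse \<sigma> ! \<phi> (\<pi> ! p) < length \<sigma>" "\<sigma> ! (perm_inverse \<sigma> ! \<phi> (\<pi> ! p)) = \<phi> (\<pi> ! p)"
    if "p < length \<pi>" for p
    using that assms(2,3) perm_nth_less perm_inverse_nth_nth perm_inverse_nth \<phi> by auto
  show ?thesis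
    unfolding gridded_contained_def prod.case
  proof (intro exI[of _ "\<lambda>p. perm_inverse \<sigma> ! \<phi> (\<pi> ! p)"] conjI allI impI)
    fix p q assume pq: "p < length \<pi>" "q < length \<pi>"
    show "p < q \<longleftrightarrow> perm_inverse \<sigma> ! \<phi> (\<pi> ! p) < perm_inverse \<sigma> ! \<phi> (\<pi> ! q)"
      if "part c p = part c q"
      using row[of "\<pi> ! p" "\<pi> ! q"] pq that * by simp
    show "\<pi> ! p < \<pi> ! q \<longleftrightarrow> \<sigma> ! (perm_inverse \<sigma> ! \<phi> (\<pi> ! p)) < \<sigma> ! (perm_inverse \<sigma> ! \<phi> (\<pi> ! q))"
      if "part r (\<pi> ! p) = part r (\<pi> ! q)"
      using col[of "\<pi> ! p" "\<pi> ! q"] pq that * by simp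
  qed (use \<phi> * in auto)
qed

section \<open>Coordinates of points under permutations and column reversals\<close>

lemma nth_concat_map_upt:
  assumes "i < m" "q < length (f i)"
  shows "concat (map f [0..<m]) ! ((\<Sum>k<i. length (f k)) + q) = f i ! q"
proof -
  have "[0..<m] = [0..<i] @ i # [Suc i..<m]"
    using assms(1) by (metis less_imp_add_positive upt_add_eq_append upt_conv_Cons
      zero_le less_imp_le_nat add_0 le_add_diff_inverse)
  moreover have "length (concat (map f [0..<i])) = (\<Sum>k<i. length (f k))"
    by (simp add: length_concat o_def sum_list_sum_nth lessThan_atLeast0)
  ultimately show ?thesis
    using assms(2) by (simp add: nth_append)
qed

text \<open>The blocks before block \<open>i\<close> have total length
  \<open>permute_dividers \<mu> c ! i\<close>, so the concatenation is read through the translation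
  of \<open>rearranges_permute\<close>.\<close>

lemma column_perm_nth:
  assumes "dividers m (length \<pi>) c" "dividers m (length \<pi>) (permute_dividers \<mu> c)" "p < length \<pi>"
  shows "concat (map (\<lambda>i. column_part \<pi> c (\<mu> i)) [0..<length c - 1]) ! p =
    \<pi> ! (c ! \<mu> (part (permute_dividers \<mu> c) p) + (p - permute_dividers \<mu> c ! part (permute_dividers \<mu> c) p))"
proof -
  let ?c' = "permute_dividers \<mu> c"
  define i where "i = part ?c' p"
  have i: "i < m" "?c' ! i \<le> p" "p < ?c' ! Suc i"
    using part_bounds[OF assms(2,3)] by (auto simp: i_def)
  have m: "length c = Suc m"
    using assms(1) by (simp add: dividers_def)
  have "?c' ! Suc i = ?c' ! i + (c ! Suc (\<mu> i) - c ! \<mu> i)"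
    using i(1) m by (simp add: permute_dividers_nth)
  then have q: "p - ?c' ! i < length (column_part \<pi> c (\<mu> i))"
    using i by (simp add: column_part_def)
  have "(\<Sum>k<i. length (column_part \<pi> c (\<mu> k))) = ?c' ! i"
    using i(1) m by (simp add: permute_dividers_nth column_part_def)
  then have "concat (map (\<lambda>i. column_part \<pi> c (\<mu> i)) [0..<m]) ! p = column_part \<pi> c (\<mu> i) ! (p - ?c' ! i)"
    using nth_concat_map_upt[of i m "p - ?c' ! i" "\<lambda>i. column_part \<pi> c (\<mu> i)"] i q by simp
  also have "\<dots> = \<pi> ! (c ! \<mu> i + (p - ?c' ! i))"
    using q by (simp add: column_part_def)
  finally show ?thesis
    by (simp add: m i_def)
qed

text \<open>\<open>v\<close> is the value that a row permutation gives to \<open>y\<close>. Both it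
  and the translation of \<open>rearranges_permute\<close> keep the offset within the row, so the
  translation undoes it.\<close>

lemma row_perm_value:
  assumes "dividers n k r" "\<nu> permutes {..<n}" "dividers n k (permute_dividers \<nu> r)" "y < k"
  defines "v \<equiv> (let j = (THE j. j < length r - 1 \<and> y \<in> {r ! \<nu> j..<r ! Suc (\<nu> j)})
    in permute_dividers \<nu> r ! j + (y - r ! \<nu> j))"
  shows "r ! \<nu> (part (permute_dividers \<nu> r) v) + (v - permute_dividers \<nu> r ! part (permute_dividers \<nu> r) v) = y"
proof -
  let ?r' = "permute_dividers \<nu> r"
  have n: "length r = Suc n"
    using assms(1) by (simp add: dividers_def)
  obtain j where j: "j < n" "\<nu> j = part r y"
    using part_bounds(1)[OF assms(1,4)] permutes_image[OF assms(2)]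
    by (metis imageE lessThan_iff)
  have y: "y \<in> {r ! \<nu> j..<r ! Suc (\<nu> j)}"
    using part_bounds(2)[OF assms(1,4)] j by simp
  \<comment> \<open>Any candidate has the old row of \<open>y\<close> as its image under
    \<open>\<nu>\<close>, and \<open>\<nu>\<close> is injective.\<close>
  have "(THE j. j < length r - 1 \<and> y \<in> {r ! \<nu> j..<r ! Suc (\<nu> j)}) = j"
  proof (rule the_equality)
    fix j' assume j': "j' < length r - 1 \<and> y \<in> {r ! \<nu> j'..<r ! Suc (\<nu> j')}"
    then have "\<nu> j' < n"
      using permutes_in_image[OF assms(2), of j'] n by simp
    then have "part r y = \<nu> j'"
      using j' part_eqI[OF assms(1)] by blast
    then show "j' = j"
      using j(2) permutes_inj[OF assms(2)] by (metis injD)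
  qed (use j y n in auto)
  then have v: "v = ?r' ! j + (y - r ! \<nu> j)"
    by (simp add: v_def)
  have "?r' ! Suc j = ?r' ! j + (r ! Suc (\<nu> j) - r ! \<nu> j)"
    using j(1) n by (simp add: permute_dividers_nth)
  then have "v \<in> {?r' ! j..<?r' ! Suc j}"
    using v y by auto
  then have "part ?r' v = j"
    using part_eqI[OF assms(3) j(1)] by simp
  then show ?thesis
    using v y by simp
qed

lemma column_reverse_nth:
  assumes "dividers m (length \<pi>) c" "i < m" "p < length \<pi>"
  shows "(take (c ! i) \<pi> @ rev (column_part \<pi> c i) @ drop (c ! Suc i) \<pi>) ! p =
    \<pi> ! (if p \<in> {c ! i..<c ! Suc i} then c ! i + c ! Suc i - Suc p else p)"
proof -
  have "c ! i \<le> c ! Suc i" "c ! Suc i \<le> length \<pi>"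
    using dividers_mono[OF assms(1), of i "Suc i"] dividers_le[OF assms(1), of "Suc i"] assms(2) by auto
  then show ?thesis
    using assms(3) by (auto simp: nth_append column_part_def rev_nth min_def intro!: arg_cong[of _ _ "(!) \<pi>"])
qed

lemma length_column_reverse:
  assumes "dividers m (length \<pi>) c" "i < m"
  shows "length (take (c ! i) \<pi> @ rev (column_part \<pi> c i) @ drop (c ! Suc i) \<pi>) = length \<pi>"
  using dividers_mono[OF assms(1), of i "Suc i"] dividers_le[OF assms(1), of "Suc i"] assms(2)
  by (simp add: column_part_def)

lemma length_column_perm:
  assumes "dividers m (length \<pi>) c" "\<mu> permutes {..<m}"
  shows "length (concat (map (\<lambda>i. column_part \<pi> c (\<mu> i)) [0..<length c - 1])) = length \<pi>"
proof -
  have m: "length c = Suc m" "c ! 0 = 0" "c ! m = length \<pi>"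
    using assms(1) by (auto simp: dividers_def)
  \<comment> \<open>The sum telescopes: the dividers are sorted, so the subtraction is never
    truncated.\<close>
  have "(\<Sum>k<i. c ! Suc k - c ! k) = c ! i" if "i \<le> m" for i
    using that
  proof (induction i)
    case (Suc i)
    then show ?case using dividers_mono[OF assms(1), of i "Suc i"] by simp
  qed (simp add: m)
  moreover have "(\<Sum>k<m. c ! Suc (\<mu> k) - c ! \<mu> k) = (\<Sum>k<m. c ! Suc k - c ! k)"
    using sum.permute[OF assms(2), of "\<lambda>k. c ! Suc k - c ! k"] by (simp add: o_def)
  moreover have "length (concat (map (\<lambda>i. column_part \<pi> c (\<mu> i)) [0..<m])) =
      (\<Sum>k<m. c ! Suc (\<mu> k) - c ! \<mu> k)"
    by (simp add: length_concat o_def sum_list_sum_nth lessThan_atLeast0 column_part_def)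
  ultimately show ?thesis
    by (simp add: m)
qed

text \<open>Reverses, complements and permutations are cases of \<open>rearranges\<close>, acting on
  positions or on values; the inverse is treated apart. The shapes of the images are assumed here
  and will come from their unique griddings.\<close>

lemma gridded_contained_op_gridded:
  assumes u: "op_applicable u M"
    and shape: "grid_shape (dim_col M) (dim_row M) (\<pi>, c, r)"
      "grid_shape (dim_col M) (dim_row M) (\<sigma>, d, s)"
    and shape': "grid_shape (dim_col (op_matrix u M)) (dim_row (op_matrix u M)) (op_gridded u (\<pi>, c, r))"
      "grid_shape (dim_col (op_matrix u M)) (dim_row (op_matrix u M)) (op_gridded u (\<sigma>, d, s))"
    and cont: "gridded_contained (op_gridded u (\<pi>, c, r)) (op_gridded u (\<sigma>, d, s))"
  shows "gridded_contained (\<pi>, c, r) (\<sigma>, d, s)"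
proof -
  have \<pi>: "\<pi> \<in> perms" "dividers (dim_col M) (length \<pi>) c" "dividers (dim_row M) (length \<pi>) r"
    and \<sigma>: "\<sigma> \<in> perms" "dividers (dim_col M) (length \<sigma>) d" "dividers (dim_row M) (length \<sigma>) s"
    using shape by (auto simp: grid_shape_def)
  show ?thesis
  proof (cases u)
    case Grid_Inverse
    then show ?thesis
      using cont \<pi>(1) \<sigma>(1) by (auto intro: gridded_contained_inverse)
  next
    case (Column_Reverse i)
    then have i: "i < dim_col M" using u by simp
    show ?thesis
      using cont unfolding Column_Reverse op_gridded.simps
      by (rule gridded_contained_rearrange_columns)
        (rule length_column_reverse rearranges_reverse column_reverse_nth \<pi> \<sigma> i | assumption)+
  next
    case (Row_Complement j)
    then have j: "j < dim_row M" using u by simp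
    \<comment> \<open>Reflection is an involution, so the same formula leads from new values back to
      old ones.\<close>
    have rev: "(if v \<in> {t ! j..<t ! Suc j} then t ! j + t ! Suc j - Suc v else v) = y"
      if "v = (if y \<in> {t ! j..<t ! Suc j} then t ! j + t ! Suc j - Suc y else y)" for v y :: nat and t
      using that by auto
    show ?thesis
      using cont unfolding Row_Complement op_gridded.simps
      by (rule gridded_contained_rearrange_rows[OF _ _ _ _ _
            rearranges_reverse[OF \<pi>(3) j] rearranges_reverse[OF \<sigma>(3) j]])
        (use shape' in \<open>auto simp: Row_Complement grid_shape_def intro!: rev\<close>)
  next
    case (Column_Perm \<mu>)
    then have \<mu>: "\<mu> permutes {..<dim_col M}" using u by simp
    \<comment> \<open>The shape of the image refers to the length of the concatenated list, which is
      first identified with the original length.\<close>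
    have div: "dividers (dim_col M) (length \<pi>) (permute_dividers \<mu> c)"
      "dividers (dim_col M) (length \<sigma>) (permute_dividers \<mu> d)"
      using shape' length_column_perm[OF \<pi>(2) \<mu>] length_column_perm[OF \<sigma>(2) \<mu>]
      by (auto simp: Column_Perm grid_shape_def)
    show ?thesis
      using cont unfolding Column_Perm op_gridded.simps
      by (rule gridded_contained_rearrange_columns)
        (rule length_column_perm rearranges_permute column_perm_nth \<pi> \<sigma> \<mu> div | assumption)+
  next
    case (Row_Perm \<nu>)
    then have \<nu>: "\<nu> permutes {..<dim_row M}" using u by simp
    have div: "dividers (dim_row M) (length \<pi>) (permute_dividers \<nu> r)"
      "dividers (dim_row M) (length \<sigma>) (permute_dividers \<nu> s)"
      using shape' by (auto simp: Row_Perm grid_shape_def)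
    show ?thesis
      using cont unfolding Row_Perm op_gridded.simps
      by (rule gridded_contained_rearrange_rows[OF _ _ _ _ _
            rearranges_permute[OF \<pi>(3) \<nu> div(1)] rearranges_permute[OF \<sigma>(3) \<nu> div(2)]])
        (use shape' row_perm_value[OF \<pi>(3) \<nu> div(1)] row_perm_value[OF \<sigma>(3) \<nu> div(2)]
            perm_nth_less[OF \<pi>(1)] perm_nth_less[OF \<sigma>(1)]
          in \<open>simp_all add: Row_Perm grid_shape_def\<close>)
  qed
qed

section \<open>Induction along the factors of a grid mapping\<close>

lemma strongly_uniquely_griddable_op:
  assumes "strongly_uniquely_griddable M g" "op_applicable u M"
  shows "strongly_uniquely_griddable (op_matrix u M) (op_gridded u g)"
proof -
  have *: "uniquely_gridded (map_matrix f M) (map_gridded f g)" if "grid_mapping_of M f" for f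
    using assms(1) that by (simp add: strongly_uniquely_griddable_def)
  show ?thesis
    \<comment> \<open>\<open>[u]\<close> gives uniqueness for the image itself; prefixing
      \<open>u\<close> turns each grid mapping of \<open>op_matrix u M\<close> into one of
      \<open>M\<close>.\<close>
    using *[of "[u]"] *[of "u # _"] assms(2)
    by (auto simp: strongly_uniquely_griddable_def map_matrix_def map_gridded_def)
qed

lemma strongly_uniquely_griddable_grid_shape:
  "strongly_uniquely_griddable M g \<Longrightarrow> grid_shape (dim_col M) (dim_row M) g"
  by (auto simp: strongly_uniquely_griddable_def uniquely_gridded_def intro: is_gridded_grid_shape)

text \<open>The head \<open>u\<close> acts first, so it is undone last: the induction hypothesis
  applies to the images under \<open>u\<close>, which are again strongly uniquely griddable. This is
  why \<open>M\<close>, \<open>g\<close> and \<open>h\<close> vary in the induction.\<close>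

lemma gridded_contained_map_gridded:
  assumes "strongly_uniquely_griddable M g" "strongly_uniquely_griddable M h" "grid_mapping_of M f"
    and "gridded_contained (map_gridded f g) (map_gridded f h)"
  shows "gridded_contained g h"
  using assms
proof (induction f arbitrary: M g h)
  case Nil
  then show ?case by (simp add: map_gridded_def)
next
  case (Cons u f)
  then have u: "op_applicable u M" by simp
  have op: "strongly_uniquely_griddable (op_matrix u M) (op_gridded u g)"
    "strongly_uniquely_griddable (op_matrix u M) (op_gridded u h)"
    using strongly_uniquely_griddable_op Cons.prems(1,2) u by blast+
  have "gridded_contained (op_gridded u g) (op_gridded u h)"
    using Cons.prems(3,4) by (intro Cons.IH[OF op]) (simp_all add: map_gridded_def)
  moreover note shapes = Cons.prems(1,2)[THEN strongly_uniquely_griddable_grid_shape]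
    op[THEN strongly_uniquely_griddable_grid_shape]
  ultimately show ?case
    by (cases g, cases h) (blast intro: gridded_contained_op_gridded[OF u])
qed

section \<open>The infinite antichain in \<open>Grid N\<close>\<close>

theorem theorem14:
  fixes M N :: "nat list set mat" and A :: "nat list set"
  assumes "gridding_matrix M"
    and "perm_antichain A"
    and "infinite {\<pi> \<in> A. \<exists>c r. strongly_uniquely_griddable M (\<pi>, c, r)}"
    and "gridding_matrix N"
    and "\<exists>f. equivalent_under f M N"
  shows "\<not> partially_well_ordered (Grid N)"
proof -
  obtain f where f: "grid_mapping_of M f" "map_matrix f M = N"
    using assms(5) by (auto simp: equivalent_under_def)
  define B where "B = {\<pi> \<in> A. \<exists>c r. strongly_uniquely_griddable M (\<pi>, c, r)}"
  have "\<forall>\<pi>\<in>B. \<exists>c r. strongly_uniquely_griddable M (\<pi>, c, r)"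
    by (simp add: B_def)
  then obtain c r where su: "\<And>\<pi>. \<pi> \<in> B \<Longrightarrow> strongly_uniquely_griddable M (\<pi>, c \<pi>, r \<pi>)"
    by metis
  \<comment> \<open>\<open>G\<close> carries the chosen griddings along \<open>f\<close>;
    \<open>F\<close> then forgets the lines.\<close>
  define G where "G = (\<lambda>\<pi>. map_gridded f (\<pi>, c \<pi>, r \<pi>))"
  define F where "F = (\<lambda>\<pi>. fst (G \<pi>))"
  have unique: "uniquely_gridded N (G \<pi>)" if "\<pi> \<in> B" for \<pi>
    using su[OF that] f by (auto simp: strongly_uniquely_griddable_def G_def)
  have gridded: "is_gridded N (G \<pi>)" if "\<pi> \<in> B" for \<pi>
    using unique[OF that] by (cases "G \<pi>") (simp add: uniquely_gridded_def)
  \<comment> \<open>Source of both the injectivity of \<open>F\<close> and the incomparability of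
    its values.\<close>
  have reflect: "\<pi> = \<sigma>" if B: "\<pi> \<in> B" "\<sigma> \<in> B" and "F \<pi> \<preceq> F \<sigma>" for \<pi> \<sigma>
  proof -
    have "gridded_contained (G \<pi>) (G \<sigma>)"
      using contained_imp_gridded_contained[OF assms(4)] unique[OF B(1)] gridded[OF B(2)]
        \<open>F \<pi> \<preceq> F \<sigma>\<close> unfolding F_def by (metis prod.collapse)
    then have "gridded_contained (\<pi>, c \<pi>, r \<pi>) (\<sigma>, c \<sigma>, r \<sigma>)"
      unfolding G_def using gridded_contained_map_gridded[OF su su f(1)] B by blast
    then have "\<pi> \<preceq> \<sigma>"
      using gridded_contained_imp_contained strongly_uniquely_griddable_grid_shape su B by blast
    then show ?thesis
      using assms(2) B by (auto simp: perm_antichain_def B_def)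
  qed
  have "inj_on F B"
    \<comment> \<open>Equal images contain each other, so \<open>reflect\<close> applies to
      them.\<close>
    by (rule inj_onI) (metis reflect contained_refl)
  then have "infinite (F ` B)"
    using assms(3) by (simp add: finite_image_iff B_def)
  moreover have "F \<pi> \<in> Grid N" if "\<pi> \<in> B" for \<pi>
    using gridded[OF that] unfolding Grid_def F_def by (metis (mono_tags) mem_Collect_eq prod.collapse)
  then have sub: "F ` B \<subseteq> Grid N"
    by blast
  moreover have "Grid N \<subseteq> perms"
    by (auto simp: Grid_def is_gridded_def)
  with sub have "F ` B \<subseteq> perms"
    by (rule subset_trans)
  then have "perm_antichain (F ` B)"
    unfolding perm_antichain_def by (metis imageE reflect)
  ultimately show ?thesis
    unfolding partially_well_ordered_def by blast
qed

end
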